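(* Let $m, n \geq 3$ be integers, and let $\gamma_{p}(f_{n\times m})$ denote the paired domination number of the flower graph $f_{n\times m}$. Then $$\gamma_{p}(f_{n \times m})= \begin{cases} 2\left\lceil \frac{nm-2n}{4}\right\rceil, & \text{if } m \equiv 0 \pmod 4,\\[4pt] 2\left\lceil \frac{nm-n}{4}\right\rceil, & \text{if } m \equiv 1, 2 \pmod 4,\\[4pt] 2\left\lceil \frac{3nm-5n}{12}\right\rceil, & \text{if } m \equiv 3 \pmod 4.\end{cases}$$
   Context: All graphs are finite and simple. For integers $m,n\ge 3$, the flower graph $f_{n\times m}$ is the graph with vertex set $\{u_i, v_{i,j} : 1\le i\le n,\ 1\le j\le m-2\}$ and edge set $E_1\cup E_2\cup E_3$, where $E_1=\{u_iu_{i+1} : 1\le i\le n\}$, $E_2=\{v_{i,j}v_{i,j+1} : 1\le i\le n,\ 1\le j\le m-3\}$, and $E_3=\{u_iv_{i,1},\ u_{i+1}v_{i,m-2} : 1\le i\le n\}$, with the index $i$ taken modulo $n$ (so $u_{n+1}=u_1$). It has $n(m-1)$ vertices and $nm$ edges. For a graph $G=(V,E)$ without isolated vertices, a set $D\subseteq V$ is a dominating set if every vertex of $V\setminus D$ is adjacent to at least one vertex of $D$. A paired dominating set is a dominating set $D$ such that the induced subgraph $\langle D\rangle$ has a perfect matching. The paired domination number $\gamma_p(G)$ is the minimum cardinality of a paired dominating set of $G$. *)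

theory Defs
  imports Complex_Main
begin

(* A graph is given by a vertex set VV and a set EE of two-element subsets of VV. *)

definition simple_graph :: "'a set \<Rightarrow> 'a set set \<Rightarrow> bool" where
  "simple_graph VV EE \<longleftrightarrow> finite VV \<and> (\<forall>e\<in>EE. e \<subseteq> VV \<and> card e = 2)"

definition no_isolated_vertices :: "'a set \<Rightarrow> 'a set set \<Rightarrow> bool" where
  "no_isolated_vertices VV EE \<longleftrightarrow> (\<forall>x\<in>VV. \<exists>y\<in>VV. {x, y} \<in> EE)"

definition dominating_set :: "'a set \<Rightarrow> 'a set set \<Rightarrow> 'a set \<Rightarrow> bool" where
  "dominating_set VV EE D \<longleftrightarrow> D \<subseteq> VV \<and> (\<forall>x\<in>VV - D. \<exists>y\<in>D. {x, y} \<in> EE)"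

definition induced_edges :: "'a set set \<Rightarrow> 'a set \<Rightarrow> 'a set set" where
  "induced_edges EE D = {e \<in> EE. e \<subseteq> D}"

definition perfect_matching :: "'a set \<Rightarrow> 'a set set \<Rightarrow> 'a set set \<Rightarrow> bool" where
  "perfect_matching VV EE M \<longleftrightarrow> M \<subseteq> EE \<and> (\<forall>x\<in>VV. \<exists>!e. e \<in> M \<and> x \<in> e)"

definition paired_dominating_set :: "'a set \<Rightarrow> 'a set set \<Rightarrow> 'a set \<Rightarrow> bool" where
  "paired_dominating_set VV EE D \<longleftrightarrow>
     dominating_set VV EE D \<and> (\<exists>M. perfect_matching D (induced_edges EE D) M)"

(* Meaningful for finite graphs without isolated vertices, which always have a
   paired dominating set. *)
definition paired_domination_number :: "'a set \<Rightarrow> 'a set set \<Rightarrow> nat" where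
  "paired_domination_number VV EE = Min (card ` {D. paired_dominating_set VV EE D})"

datatype flower_vertex = U nat | V nat nat

definition flower_vertices :: "nat \<Rightarrow> nat \<Rightarrow> flower_vertex set" where
  "flower_vertices n m = {U i | i. i \<in> {1..n}} \<union> {V i j | i j. i \<in> {1..n} \<and> j \<in> {1..m - 2}}"

(* Indices run over 1, ..., n, and i mod n + 1 is the cyclic successor of i:
   it is i + 1 for i < n, and 1 for i = n. *)
definition flower_edges :: "nat \<Rightarrow> nat \<Rightarrow> flower_vertex set set" where
  "flower_edges n m =
     {{U i, U (i mod n + 1)} | i. i \<in> {1..n}}
   \<union> {{V i j, V i (j + 1)} | i j. i \<in> {1..n} \<and> j \<in> {1..m - 3}}
   \<union> ({{U i, V i 1} | i. i \<in> {1..n}} \<union> {{U (i mod n + 1), V i (m - 2)} | i. i \<in> {1..n}})"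

lemma cyclic_succ:
  fixes n i :: nat
  assumes "n \<ge> 3" "i \<in> {1..n}"
  shows "i mod n + 1 \<in> {1..n}" "i mod n + 1 \<noteq> i"
proof -
  have "i mod n = (if i = n then 0 else i)" using assms by simp
  thus "i mod n + 1 \<in> {1..n}" "i mod n + 1 \<noteq> i" using assms by auto
qed

lemma simple_graph_flower:
  assumes "m \<ge> 3" "n \<ge> 3"
  shows "simple_graph (flower_vertices n m) (flower_edges n m)"
proof -
  have "flower_vertices n m = U ` {1..n} \<union> (\<lambda>(i, j). V i j) ` ({1..n} \<times> {1..m - 2})"
    unfolding flower_vertices_def by auto
  hence "finite (flower_vertices n m)" by simp
  moreover have "e \<subseteq> flower_vertices n m \<and> card e = 2" if "e \<in> flower_edges n m" for e
  proof -
    consider i where "i \<in> {1..n}" "e = {U i, U (i mod n + 1)}"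
      | i j where "i \<in> {1..n}" "j \<in> {1..m - 3}" "e = {V i j, V i (j + 1)}"
      | i where "i \<in> {1..n}" "e = {U i, V i 1}"
      | i where "i \<in> {1..n}" "e = {U (i mod n + 1), V i (m - 2)}"
      using \<open>e \<in> flower_edges n m\<close> unfolding flower_edges_def by blast
    thus ?thesis
    proof cases
      case (1 i)
      with cyclic_succ[OF assms(2) 1(1)] show ?thesis
        unfolding flower_vertices_def by (auto simp: card_2_iff)
    next
      case (2 i j)
      hence "j + 1 \<in> {1..m - 2}" "j \<in> {1..m - 2}" using assms by auto
      with 2 show ?thesis unfolding flower_vertices_def by (auto simp: card_2_iff)
    next
      case (3 i)
      with assms show ?thesis unfolding flower_vertices_def by auto
    next
      case (4 i)
      with assms cyclic_succ[OF assms(2) 4(1)] show ?thesis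
        unfolding flower_vertices_def by auto
    qed
  qed
  ultimately show ?thesis unfolding simple_graph_def by blast
qed

lemma flower_edges_intros:
  assumes "i \<in> {1..n}"
  shows "{U i, V i 1} \<in> flower_edges n m"
    and "j \<in> {1..m - 3} \<Longrightarrow> {V i j, V i (j + 1)} \<in> flower_edges n m"
proof -
  show "{U i, V i 1} \<in> flower_edges n m"
    unfolding flower_edges_def
    by (rule UnI2, rule UnI1, rule CollectI, rule exI[of _ i], intro conjI refl assms)
  show "{V i j, V i (j + 1)} \<in> flower_edges n m" if "j \<in> {1..m - 3}"
    unfolding flower_edges_def
    by (rule UnI1, rule UnI2, rule CollectI, rule exI[of _ i], rule exI[of _ j],
        intro conjI refl assms that)
qed

lemma no_isolated_vertices_flower:
  assumes "m \<ge> 3" "n \<ge> 3"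
  shows "no_isolated_vertices (flower_vertices n m) (flower_edges n m)"
  unfolding no_isolated_vertices_def
proof
  fix x assume "x \<in> flower_vertices n m"
  then consider i where "i \<in> {1..n}" "x = U i"
    | i j where "i \<in> {1..n}" "j \<in> {1..m - 2}" "x = V i j"
    unfolding flower_vertices_def by blast
  thus "\<exists>y\<in>flower_vertices n m. {x, y} \<in> flower_edges n m"
  proof cases
    case (1 i)
    hence "{x, V i 1} \<in> flower_edges n m" using flower_edges_intros(1) by simp
    moreover have "V i 1 \<in> flower_vertices n m"
      using 1 assms unfolding flower_vertices_def by auto
    ultimately show ?thesis by blast
  next
    case (2 i j)
    show ?thesis
    proof (cases "j = 1")
      case True
      with 2 have "{U i, x} \<in> flower_edges n m" using flower_edges_intros(1) by simp
      hence "{x, U i} \<in> flower_edges n m" by (simp add: insert_commute)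
      moreover have "U i \<in> flower_vertices n m" using 2 unfolding flower_vertices_def by auto
      ultimately show ?thesis by blast
    next
      case False
      with 2 have j: "j - 1 \<in> {1..m - 3}" "j - 1 + 1 = j" by auto
      with 2 have "{V i (j - 1), x} \<in> flower_edges n m"
        using flower_edges_intros(2)[OF 2(1) j(1)] by simp
      hence "{x, V i (j - 1)} \<in> flower_edges n m" by (simp add: insert_commute)
      moreover have "V i (j - 1) \<in> flower_vertices n m"
        using 2 j unfolding flower_vertices_def by auto
      ultimately show ?thesis by blast
    qed
  qed
qed

end

theory Submission
  imports Defs
begin

text \<open>
  Call the path between two consecutive hubs \<open>U i\<close> and \<open>U (i + 1)\<close>, together with the hubs and the
  edge joining them, the \<open>i\<close>-th petal; it has \<open>L = m - 2\<close> interior vertices. Write \<open>L = 4k + r\<close> with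
  \<open>r < 4\<close>. The three formulas of the theorem are instances of a single one,
  \<open>\<gamma>\<^sub>p = 2 (n k + \<lceil>n / (4 - r)\<rceil>)\<close>,
  and the reason is that every petal costs \<open>k\<close> matching edges, while one further edge is needed and
  suffices for every \<open>4 - r\<close> consecutive petals.
  
  A paired dominating set is the vertex set of a matching, so half of \<open>\<gamma>\<^sub>p\<close> is the least size of a
  matching \<open>M\<close> whose vertices dominate (\<open>paired_domination_number_eqI\<close>). The \<open>n m\<close> edges split into the
  \<open>m\<close> edges of each petal, so the size of \<open>M\<close> is the sum over the petals of the number of their
  edges used by \<open>M\<close>.
  
  For the lower bound, an edge of \<open>M\<close> between two interior vertices dominates at most four interior
  vertices, and each end of the petal helps with at most one more vertex, or with two if its hub is
  matched into the petal. Counting shows that every petal uses at least \<open>k\<close> edges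
  (\<open>petal_uses_at_least\<close>). If it uses exactly \<open>k\<close>, it is called tight; all its edges are then
  interior, and at least \<open>r\<close> of its two hubs are matched (\<open>tightD\<close>). But a hub between two tight
  petals has no incident edge in \<open>M\<close>, so too many consecutive tight petals contradict this: there
  are never \<open>4 - r\<close> of them in a row (\<open>window_not_tight\<close>). For \<open>r = 0\<close> the contradiction comes from the
  hubs, since the middle hub of four tight petals would be undominated. Summing the excess over all
  cyclic windows of \<open>4 - r\<close> petals gives the bound.
  
  For the upper bound, the hubs are grouped into blocks of \<open>4 - r\<close>, and the first two hubs of each block
  are matched with each other. This dominates all the hubs around them and, at the ends of the petals
  around them, so many interior vertices that \<open>k\<close> evenly spaced interior edges per petal suffice for the
  rest. An incomplete last block is served by one edge from a hub into its petal; for \<open>r = 3\<close> every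
  petal gets such an edge.
\<close>

section \<open>Paired domination as domination by matchings\<close>

definition matching :: "'a set set \<Rightarrow> bool" where
  "matching M \<longleftrightarrow> (\<forall>e\<in>M. \<forall>f\<in>M. e \<inter> f \<noteq> {} \<longrightarrow> e = f)"

text \<open>
  A perfect matching of the graph induced on \<open>D\<close> is the same as a matching of the whole graph whose
  vertex set is \<open>D\<close>, which makes it possible to forget \<open>D\<close> and to argue about edges only.
\<close>

lemma paired_dominating_set_iff_matching:
  "paired_dominating_set VV EE D \<longleftrightarrow>
     dominating_set VV EE D \<and> (\<exists>M. M \<subseteq> EE \<and> matching M \<and> \<Union>M = D)"
proof -
  have "(\<exists>M. perfect_matching D (induced_edges EE D) M) \<longleftrightarrow> (\<exists>M. M \<subseteq> EE \<and> matching M \<and> \<Union>M = D)"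
  proof (rule iff_exI)
    fix M
    show "perfect_matching D (induced_edges EE D) M \<longleftrightarrow> M \<subseteq> EE \<and> matching M \<and> \<Union>M = D"
    proof
      assume pm: "perfect_matching D (induced_edges EE D) M"
      then have *: "M \<subseteq> EE" "\<Union>M \<subseteq> D" and ex1: "\<forall>x\<in>D. \<exists>!e. e \<in> M \<and> x \<in> e"
        unfolding perfect_matching_def induced_edges_def by auto
      have "D \<subseteq> \<Union>M" using ex1 by blast
      moreover have "e = f" if "e \<in> M" "f \<in> M" "x \<in> e" "x \<in> f" for e f x
      proof -
        have "x \<in> D" using * that by blast
        then show ?thesis using ex1 that by blast
      qed
      then have "matching M" unfolding matching_def by auto
      ultimately show "M \<subseteq> EE \<and> matching M \<and> \<Union>M = D" using * by simp
    next
      assume *: "M \<subseteq> EE \<and> matching M \<and> \<Union>M = D"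
      have "\<exists>!e. e \<in> M \<and> x \<in> e" if "x \<in> D" for x
      proof -
        have "x \<in> \<Union>M" using * that by simp
        then obtain e where "e \<in> M" "x \<in> e" ..
        then show ?thesis using * unfolding matching_def by (intro ex1I[of _ e]) auto
      qed
      moreover have "M \<subseteq> induced_edges EE D" using * unfolding induced_edges_def by auto
      ultimately show "perfect_matching D (induced_edges EE D) M"
        unfolding perfect_matching_def by simp
    qed
  qed
  then show ?thesis unfolding paired_dominating_set_def by simp
qed

lemma card_Union_matching:
  assumes "simple_graph VV EE" "M \<subseteq> EE" "matching M"
  shows "card (\<Union>M) = 2 * card M"
proof -
  have sub: "\<Union>M \<subseteq> VV" and fin: "finite VV" and two: "\<forall>e\<in>M. card e = 2"
    using assms unfolding simple_graph_def by blast+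
  have "finite (\<Union>M)" using sub fin finite_subset by blast
  then have "finite M" using finite_UnionD by blast
  then have "2 * card M = card (\<Union>M)"
    by (rule card_partition) (use \<open>finite (\<Union>M)\<close> two assms(3) in \<open>auto simp: matching_def\<close>)
  then show ?thesis by simp
qed

lemma paired_domination_number_eqI:
  assumes G: "simple_graph VV EE"
    and lower: "\<And>M. M \<subseteq> EE \<Longrightarrow> matching M \<Longrightarrow> dominating_set VV EE (\<Union>M) \<Longrightarrow> t \<le> card M"
    and M: "M \<subseteq> EE" "matching M" "dominating_set VV EE (\<Union>M)" "card M \<le> t"
  shows "paired_domination_number VV EE = 2 * t"
proof -
  let ?P = "{D. paired_dominating_set VV EE D}"
  have "?P \<subseteq> Pow VV" unfolding paired_dominating_set_def dominating_set_def by blast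
  moreover have "finite VV" using G unfolding simple_graph_def by blast
  ultimately have "finite ?P" by (meson finite_Pow_iff finite_subset)
  have "\<Union>M \<in> ?P" using M unfolding paired_dominating_set_iff_matching by auto
  moreover have "card (\<Union>M) = 2 * t"
    using card_Union_matching[OF G M(1,2)] M lower[OF M(1-3)] by simp
  ultimately have "2 * t \<in> card ` ?P" by (metis imageI)
  moreover have "2 * t \<le> card D" if "D \<in> ?P" for D
  proof -
    have D: "dominating_set VV EE D" and "\<exists>M'. M' \<subseteq> EE \<and> matching M' \<and> \<Union>M' = D"
      using that by (simp_all add: paired_dominating_set_iff_matching)
    from this(2) obtain M' where "M' \<subseteq> EE \<and> matching M' \<and> \<Union>M' = D" ..
    then show ?thesis using D card_Union_matching[OF G, of M'] lower[of M'] by auto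
  qed
  ultimately show ?thesis
    unfolding paired_domination_number_def using \<open>finite ?P\<close> by (intro Min_eqI) auto
qed

section \<open>Cyclic windows\<close>

text \<open>
  Double counting: summing the window totals over all starting points counts every term \<open>w\<close> times,
  and every total is at least \<open>1\<close>.
\<close>

lemma card_le_window_sum:
  fixes z :: "'a \<Rightarrow> nat"
  assumes "finite I" "bij_betw s I I" "\<And>i. i \<in> I \<Longrightarrow> \<exists>d<w. z ((s ^^ d) i) > 0"
  shows "card I \<le> w * sum z I"
proof -
  note bij = bij_betw_funpow[OF assms(2)]
  have "card I = (\<Sum>i\<in>I. 1)" by simp
  also have "\<dots> \<le> (\<Sum>i\<in>I. \<Sum>d<w. z ((s ^^ d) i))"
  proof (rule sum_mono)
    fix i assume "i \<in> I"
    then obtain d where d: "d < w" "z ((s ^^ d) i) > 0" using assms(3) by blast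
    then have "z ((s ^^ d) i) \<le> (\<Sum>d<w. z ((s ^^ d) i))"
      by (intro member_le_sum) auto
    then show "1 \<le> (\<Sum>d<w. z ((s ^^ d) i))" using d(2) by linarith
  qed
  also have "\<dots> = (\<Sum>d<w. \<Sum>i\<in>I. z ((s ^^ d) i))" by (rule sum.swap)
  also have "\<dots> = (\<Sum>d<w. sum z I)" by (simp add: sum.reindex_bij_betw[OF bij])
  also have "\<dots> = w * sum z I" by simp
  finally show ?thesis .
qed

section \<open>The petals of a flower graph\<close>

locale flower =
  fixes n L :: nat
  assumes n: "n \<ge> 3" and L: "L \<ge> 1"
begin

definition nxt :: "nat \<Rightarrow> nat" where "nxt i = i mod n + 1"

abbreviation "I \<equiv> {1..n}"
abbreviation "VV \<equiv> flower_vertices n (L + 2)"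
abbreviation "EE \<equiv> flower_edges n (L + 2)"

text \<open>
  The petal is a cycle of length \<open>L + 2\<close>, with \<open>U i\<close> at position \<open>0\<close>, \<open>V i j\<close> at position \<open>j\<close> and the
  next hub at position \<open>L + 1\<close>. Edge \<open>q\<close> leads from position \<open>q\<close> to position \<open>q + 1\<close>, and the last one,
  the chord between the hubs, closes the cycle.
\<close>

definition petal_edge :: "nat \<Rightarrow> nat \<Rightarrow> flower_vertex set" where
  "petal_edge i q =
     (if q = 0 then {U i, V i 1} else if q < L then {V i q, V i (q + 1)}
      else if q = L then {U (nxt i), V i L} else {U i, U (nxt i)})"

lemma nxt_eq: "i \<in> I \<Longrightarrow> nxt i = (if i = n then 1 else i + 1)"
  unfolding nxt_def using n by auto

lemma nxt_in: "i \<in> I \<Longrightarrow> nxt i \<in> I"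
  using n by (auto simp: nxt_eq)

lemma nxt_neq: "i \<in> I \<Longrightarrow> nxt i \<noteq> i" "i \<in> I \<Longrightarrow> nxt (nxt i) \<noteq> i"
  using n nxt_in[of i] by (auto simp: nxt_eq)

lemma nxt_inj: assumes "i \<in> I" "j \<in> I" "nxt i = nxt j" shows "i = j"
proof -
  have "(if i = n then 1 else i + 1) = (if j = n then 1 else j + 1)" "1 \<le> i" "1 \<le> j"
    using nxt_eq[OF assms(1)] nxt_eq[OF assms(2)] assms by (metis, auto)
  then show ?thesis by presburger
qed

lemma nxt_bij: "bij_betw nxt I I"
proof -
  have "inj_on nxt I" using nxt_inj by (auto intro: inj_onI)
  then show ?thesis
    unfolding bij_betw_def using endo_inj_surj[of I nxt] nxt_in by blast
qed

lemma mem_VV: "U i \<in> VV \<longleftrightarrow> i \<in> I" "V i j \<in> VV \<longleftrightarrow> i \<in> I \<and> j \<in> {1..L}"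
  unfolding flower_vertices_def by auto

lemma petal_edge_cases:
  assumes "q \<le> L + 1"
  obtains (first) "q = 0" "petal_edge i q = {U i, V i 1}"
    | (inner) "q \<in> {1..<L}" "petal_edge i q = {V i q, V i (q + 1)}"
    | (last) "q = L" "petal_edge i q = {U (nxt i), V i L}"
    | (chord) "q = L + 1" "petal_edge i q = {U i, U (nxt i)}"
proof -
  consider "q = 0" | "q \<in> {1..<L}" | "q = L" | "q = L + 1"
    using assms by fastforce
  then show thesis
  proof cases
    case 1 show thesis by (rule first) (simp_all add: petal_edge_def 1)
  next
    case 2 then show thesis by (intro inner) (simp_all add: petal_edge_def)
  next
    case 3 show thesis by (rule last) (use L in \<open>simp_all add: petal_edge_def 3\<close>)
  next
    case 4 show thesis by (rule chord) (simp_all add: petal_edge_def 4)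
  qed
qed

lemma EE_eq: "EE = {petal_edge i q | i q. i \<in> I \<and> q \<le> L + 1}"
proof (rule set_eqI)
  fix e
  have L2: "L + 2 - 2 = L" "L + 2 - 3 = L - 1" by simp_all
  let ?R = "{petal_edge i q | i q. i \<in> I \<and> q \<le> L + 1}"
  have R: "e \<in> ?R" if "i \<in> I" "q \<le> L + 1" "petal_edge i q = e" for i q
    by (rule CollectI, rule exI[of _ i], rule exI[of _ q], intro conjI that(1,2) that(3)[symmetric])
  have sub: "e \<in> ?R" if "e \<in> EE"
    using that unfolding flower_edges_def L2 nxt_def[symmetric]
  proof (elim UnE CollectE exE conjE)
    fix i assume "i \<in> I" "e = {U i, U (nxt i)}"
    then show ?thesis by (intro R[of i "L + 1"]) (simp_all add: petal_edge_def)
  next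
    fix i j assume "i \<in> I" "j \<in> {1..L - 1}" "e = {V i j, V i (j + 1)}"
    moreover from this have "0 < j" "j < L" by auto
    ultimately show ?thesis by (intro R[of i j]) (simp_all add: petal_edge_def)
  next
    fix i assume "i \<in> I" "e = {U i, V i 1}"
    then show ?thesis by (intro R[of i 0]) (simp_all add: petal_edge_def)
  next
    fix i assume "i \<in> I" "e = {U (nxt i), V i L}"
    then show ?thesis using L by (intro R[of i L]) (simp_all add: petal_edge_def)
  qed
  have sup: "petal_edge i q \<in> EE" if i: "i \<in> I" and q: "q \<le> L + 1" for i q
    using q
  proof (cases rule: petal_edge_cases[of q i])
    case first
    show ?thesis unfolding first(2) by (rule flower_edges_intros(1)[OF i])
  next
    case inner
    have "q \<in> {1..L + 2 - 3}" using inner(1) by auto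
    then show ?thesis unfolding inner(2) by (rule flower_edges_intros(2)[OF i])
  next
    case last
    show ?thesis unfolding last(2) flower_edges_def L2 nxt_def
      by (rule UnI2, rule UnI2, rule CollectI, rule exI[of _ i], intro conjI refl i)
  next
    case chord
    show ?thesis unfolding chord(2) flower_edges_def nxt_def
      by (rule UnI1, rule UnI1, rule CollectI, rule exI[of _ i], intro conjI refl i)
  qed
  show "e \<in> EE \<longleftrightarrow> e \<in> ?R"
  proof
    assume "e \<in> ?R"
    then show "e \<in> EE" by (elim CollectE exE conjE) (simp only: sup)
  qed (rule sub)
qed

lemma V_in_petal_edge:
  assumes "V i j \<in> petal_edge i' q" "q \<le> L + 1"
  shows "i' = i \<and> (j = q \<or> j = q + 1) \<and> 1 \<le> j \<and> j \<le> L"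
proof (cases rule: petal_edge_cases[OF assms(2), of i'])
  case 2
  then have "i = i'" "j = q \<or> j = q + 1" using assms(1) by (simp_all, blast+)
  then show ?thesis using 2(1) by auto
qed (use assms(1) L in simp_all)

lemma U_in_petal_edge:
  assumes "U j \<in> petal_edge i q" "q \<le> L + 1"
  shows "j = i \<and> (q = 0 \<or> q = L + 1) \<or> j = nxt i \<and> (q = L \<or> q = L + 1)"
  by (cases rule: petal_edge_cases[OF assms(2), of i]) (use assms(1) in simp_all)

text \<open>
  This needs \<open>n \<ge> 3\<close>: for \<open>n = 2\<close> the two chords would coincide. Injectivity makes the
  size of a matching the sum of its contributions from the petals.
\<close>

lemma petal_edge_inj: "inj_on (\<lambda>(i, q). petal_edge i q) (I \<times> {..L + 1})"
proof -
  have *: "i = j \<and> q = r" if ij: "i \<in> I" "j \<in> I" and q: "q \<le> L + 1" and r: "r \<le> L + 1"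
    and eq: "petal_edge i q = petal_edge j r" for i q j r
  proof -
    have V_in: "j = i \<and> (x = r \<or> x = r + 1)" if "V i x \<in> petal_edge i q" for x
      using V_in_petal_edge that r unfolding eq by blast
    have U_in: "x = j \<and> (r = 0 \<or> r = L + 1) \<or> x = nxt j \<and> (r = L \<or> r = L + 1)"
      if "U x \<in> petal_edge i q" for x
      using U_in_petal_edge that r unfolding eq by blast
    note nxt = nxt_neq[OF ij(1)] nxt_neq[OF ij(2)] nxt_inj[OF ij]
    show "i = j \<and> q = r"
    proof (cases rule: petal_edge_cases[OF q, of i])
      case 1
      then have "V i 1 \<in> petal_edge i q" "U i \<in> petal_edge i q" by simp_all
      note in1 = V_in[OF this(1)] U_in[OF this(2)]
      then have "j = i" by blast
      then have "r = 0 \<or> r = L + 1" using in1(2) nxt by metis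
      moreover have "r \<le> 1" using in1(1) by linarith
      ultimately show ?thesis using \<open>j = i\<close> 1(1) L by linarith
    next
      case 2
      then have "V i q \<in> petal_edge i q" "V i (q + 1) \<in> petal_edge i q" by simp_all
      note in2 = V_in[OF this(1)] V_in[OF this(2)]
      then show ?thesis by linarith
    next
      case 3
      then have "V i L \<in> petal_edge i q" "U (nxt i) \<in> petal_edge i q" by simp_all
      note in3 = V_in[OF this(1)] U_in[OF this(2)]
      then have "j = i" by blast
      then have "r = L \<or> r = L + 1" using in3(2) nxt by metis
      moreover have "r \<le> L" using in3(1) by linarith
      ultimately show ?thesis using \<open>j = i\<close> 3(1) by linarith
    next
      case 4
      then have "U i \<in> petal_edge i q" "U (nxt i) \<in> petal_edge i q" by simp_all
      note in4 = U_in[OF this(1)] U_in[OF this(2)]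
      have "i = j" using in4 nxt by metis
      then have "r = 0 \<or> r = L + 1" "r = L \<or> r = L + 1" using in4 nxt by metis+
      then have "r = L + 1" using L by linarith
      then show ?thesis using \<open>i = j\<close> 4(1) by blast
    qed
  qed
  show ?thesis
  proof (rule inj_onI)
    fix x y assume x: "x \<in> I \<times> {..L + 1}" and y: "y \<in> I \<times> {..L + 1}"
      and eq: "(case x of (i, q) \<Rightarrow> petal_edge i q) = (case y of (i, q) \<Rightarrow> petal_edge i q)"
    have "fst x = fst y \<and> snd x = snd y"
      by (rule *[OF _ _ _ _ eq[unfolded split_beta]]) (use x y in \<open>simp_all add: mem_Times_iff\<close>)
    then show "x = y" by (rule conjE) (rule prod_eqI)
  qed
qed

lemma V_adjacent:
  assumes "{V i j, y} \<in> EE"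
  shows "y = U i \<and> j = 1 \<or> y = U (nxt i) \<and> j = L
    \<or> y = V i (j - 1) \<and> j > 1 \<or> y = V i (j + 1) \<and> j < L"
proof -
  obtain i' q where *: "{V i j, y} = petal_edge i' q" "q \<le> L + 1"
    using assms unfolding EE_eq by blast
  show ?thesis
  proof (cases rule: petal_edge_cases[OF *(2), of i'])
    case 1
    have "{V i j, y} = {U i', V i' 1}" by (rule trans[OF *(1) 1(2)])
    then show ?thesis by (auto simp: doubleton_eq_iff)
  next
    case 2
    have "{V i j, y} = {V i' q, V i' (q + 1)}" by (rule trans[OF *(1) 2(2)])
    then show ?thesis using 2(1) by (auto simp: doubleton_eq_iff)
  next
    case 3
    have "{V i j, y} = {U (nxt i'), V i' L}" by (rule trans[OF *(1) 3(2)])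
    then show ?thesis by (auto simp: doubleton_eq_iff)
  next
    case 4
    have "{V i j, y} = {U i', U (nxt i')}" by (rule trans[OF *(1) 4(2)])
    then show ?thesis by (auto simp: doubleton_eq_iff)
  qed
qed

lemma U_adjacent:
  assumes "{U j, y} \<in> EE"
  shows "y = U (nxt j) \<or> y = V j 1 \<or> (\<exists>i\<in>I. j = nxt i \<and> (y = U i \<or> y = V i L))"
proof -
  obtain i q where *: "{U j, y} = petal_edge i q" "q \<le> L + 1" "i \<in> I"
    using assms unfolding EE_eq by blast
  show ?thesis
  proof (cases rule: petal_edge_cases[OF *(2), of i])
    case 1
    have "{U j, y} = {U i, V i 1}" by (rule trans[OF *(1) 1(2)])
    then show ?thesis by (auto simp: doubleton_eq_iff)
  next
    case 2
    have "{U j, y} = {V i q, V i (q + 1)}" by (rule trans[OF *(1) 2(2)])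
    then show ?thesis by (auto simp: doubleton_eq_iff)
  next
    case 3
    have "{U j, y} = {U (nxt i), V i L}" by (rule trans[OF *(1) 3(2)])
    then show ?thesis using *(3) by (auto simp: doubleton_eq_iff)
  next
    case 4
    have "{U j, y} = {U i, U (nxt i)}" by (rule trans[OF *(1) 4(2)])
    then show ?thesis using *(3) by (auto simp: doubleton_eq_iff)
  qed
qed

section \<open>The lower bound\<close>

definition used :: "flower_vertex set set \<Rightarrow> nat \<Rightarrow> nat set" where
  "used M i = {q. q \<le> L + 1 \<and> petal_edge i q \<in> M}"

lemma finite_used: "finite (used M i)"
  unfolding used_def by simp

lemma card_eq_sum_used:
  assumes "M \<subseteq> EE"
  shows "card M = (\<Sum>i\<in>I. card (used M i))"
proof -
  let ?f = "\<lambda>(i, q). petal_edge i q" and ?S = "SIGMA i:I. used M i"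
  have "M = ?f ` ?S"
  proof (intro equalityI subsetI)
    fix e assume "e \<in> M"
    then obtain i q where "e = petal_edge i q" "i \<in> I" "q \<le> L + 1"
      using assms unfolding EE_eq by blast
    then have "(i, q) \<in> ?S" "e = ?f (i, q)"
      using \<open>e \<in> M\<close> by (auto simp: used_def)
    then show "e \<in> ?f ` ?S" by blast
  qed (auto simp: used_def)
  moreover have "inj_on ?f ?S"
    using petal_edge_inj by (rule inj_on_subset) (auto simp: used_def)
  ultimately have "card M = card ?S" using card_image by metis
  then show ?thesis by (simp add: finite_used)
qed

lemma V_matched:
  assumes "M \<subseteq> EE" "V i j \<in> \<Union>M"
  obtains q where "q \<in> used M i" "j = q \<or> j = q + 1" "1 \<le> j" "j \<le> L"
proof -
  obtain e where "e \<in> M" "V i j \<in> e" using assms(2) ..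
  moreover obtain i' q where e: "e = petal_edge i' q" "q \<le> L + 1"
    using \<open>e \<in> M\<close> assms(1) unfolding EE_eq by blast
  ultimately show thesis
    using that[of q] V_in_petal_edge[of i j i' q] by (auto simp: used_def)
qed

lemma U_matched:
  assumes "M \<subseteq> EE" "U j \<in> \<Union>M"
  obtains i where "i \<in> I" "j = i" "0 \<in> used M i \<or> L + 1 \<in> used M i"
    | i where "i \<in> I" "j = nxt i" "L \<in> used M i \<or> L + 1 \<in> used M i"
proof -
  obtain e where "e \<in> M" "U j \<in> e" using assms(2) ..
  moreover obtain i q where e: "e = petal_edge i q" "q \<le> L + 1" "i \<in> I"
    using \<open>e \<in> M\<close> assms(1) unfolding EE_eq by blast
  ultimately have "q \<in> used M i"
      "j = i \<and> (q = 0 \<or> q = L + 1) \<or> j = nxt i \<and> (q = L \<or> q = L + 1)"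
    using U_in_petal_edge[of j i q] by (simp_all add: used_def)
  then show thesis using that e(3) by blast
qed

lemma end_matched:
  "0 \<in> used M i \<Longrightarrow> U i \<in> \<Union>M"
  "L \<in> used M i \<Longrightarrow> U (nxt i) \<in> \<Union>M"
proof -
  assume "0 \<in> used M i"
  then have "petal_edge i 0 \<in> M" by (simp add: used_def)
  moreover have "U i \<in> petal_edge i 0" by (simp add: petal_edge_def)
  ultimately show "U i \<in> \<Union>M" ..
next
  assume "L \<in> used M i"
  then have "petal_edge i L \<in> M" by (simp add: used_def)
  moreover have "U (nxt i) \<in> petal_edge i L" using L by (simp add: petal_edge_def)
  ultimately show "U (nxt i) \<in> \<Union>M" ..
qed

text \<open>
  An upper estimate for the positions in the petal that are dominated by \<open>M\<close>, split by the reason: an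
  interior edge at \<open>q\<close> reaches \<open>q - 1, \<dots>, q + 2\<close>, a matched hub reaches its neighbour in the petal, and a
  hub matched into the petal reaches one vertex further. The estimate may contain the hub positions
  \<open>0\<close> and \<open>L + 1\<close>; in a tight petal for \<open>r = 0\<close> this overshoot is what rules out an interior edge at the
  end of the petal.
\<close>

definition reach :: "flower_vertex set set \<Rightarrow> nat \<Rightarrow> nat set" where
  "reach M i = (\<Union>q\<in>used M i \<inter> {1..<L}. {q - 1..q + 2})
     \<union> ({x. x = 1 \<and> U i \<in> \<Union>M} \<union> {x. x = 2 \<and> 0 \<in> used M i}
     \<union> {x. x = L \<and> U (nxt i) \<in> \<Union>M} \<union> {x. x = L - 1 \<and> L \<in> used M i})"

text \<open>
  The vertex at \<open>x\<close> is an end of some used edge, and \<open>j\<close> is at most one step away from \<open>x\<close>. The three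
  cases are the three reasons in the definition of \<open>reach\<close>.
\<close>

lemma matched_in_reach:
  assumes "M \<subseteq> EE" "V i x \<in> \<Union>M" "x \<le> j + 1" "j \<le> x + 1" "1 \<le> j" "j \<le> L"
  shows "j \<in> reach M i"
proof -
  obtain q where q: "q \<in> used M i" "x = q \<or> x = q + 1" "1 \<le> x" "x \<le> L"
    using V_matched[OF assms(1,2)] by blast
  consider "q = 0" | "q \<in> {1..<L}" | "q = L"
    using q by fastforce
  then show ?thesis
  proof cases
    case 1
    then have "U i \<in> \<Union>M" "j = 1 \<or> j = 2" using q assms end_matched(1) by auto
    then show ?thesis using 1 q(1) unfolding reach_def by blast
  next
    case 2
    then have "j \<in> {q - 1..q + 2}" using q assms by auto
    then show ?thesis using 2 q(1) unfolding reach_def by blast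
  next
    case 3
    then have "U (nxt i) \<in> \<Union>M" "j = L \<or> j = L - 1" using q assms end_matched(2) by auto
    then show ?thesis using 3 q(1) unfolding reach_def by blast
  qed
qed

lemma petal_reached:
  assumes M: "M \<subseteq> EE" and dom: "dominating_set VV EE (\<Union>M)" and i: "i \<in> I"
  shows "{1..L} \<subseteq> reach M i"
proof
  fix j assume j: "j \<in> {1..L}"
  show "j \<in> reach M i"
  proof (cases "V i j \<in> \<Union>M")
    case True
    then show ?thesis using matched_in_reach[OF M] j by simp
  next
    case False
    moreover have "V i j \<in> VV" using i j mem_VV by simp
    ultimately obtain y where y: "y \<in> \<Union>M" "{V i j, y} \<in> EE"
      using dom unfolding dominating_set_def by blast
    from V_adjacent[OF y(2)] show ?thesis
    proof (elim disjE conjE)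
      assume "y = U i" "j = 1"
      then show ?thesis using y(1) unfolding reach_def by blast
    next
      assume "y = U (nxt i)" "j = L"
      then show ?thesis using y(1) unfolding reach_def by blast
    next
      assume "y = V i (j - 1)" "j > 1"
      then show ?thesis using y(1) j by (intro matched_in_reach[OF M, of i "j - 1"]) auto
    next
      assume "y = V i (j + 1)" "j < L"
      then show ?thesis using y(1) j by (intro matched_in_reach[OF M, of i "j + 1"]) auto
    qed
  qed
qed

lemma card_inner_reach:
  "card (\<Union>q\<in>used M i \<inter> {1..<L}. {q - 1..q + 2}) \<le> 4 * card (used M i \<inter> {1..<L})"
proof -
  have "card (\<Union>q\<in>used M i \<inter> {1..<L}. {q - 1..q + 2})
      \<le> (\<Sum>q\<in>used M i \<inter> {1..<L}. card {q - 1..q + 2})"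
    by (rule card_UN_le) (simp add: finite_used)
  also have "\<dots> = (\<Sum>q\<in>used M i \<inter> {1..<L}. 4)"
    by (rule sum.cong) auto
  finally show ?thesis by simp
qed

lemma card_reach:
  "card (reach M i) \<le> 4 * card (used M i \<inter> {1..<L}) + of_bool (U i \<in> \<Union>M)
     + of_bool (0 \<in> used M i) + of_bool (U (nxt i) \<in> \<Union>M) + of_bool (L \<in> used M i)"
proof -
  have "card (P \<union> (Q \<union> R \<union> S \<union> T)) \<le> card P + (card Q + card R + card S + card T)"
    for P Q R S T :: "nat set"
    using card_Un_le[of P "Q \<union> R \<union> S \<union> T"] card_Un_le[of "Q \<union> R \<union> S" T]
      card_Un_le[of "Q \<union> R" S] card_Un_le[of Q R] by linarith
  from this show ?thesis
    unfolding reach_def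
    by (rule order_trans) (use card_inner_reach[of M i] in \<open>simp del: Collect_conj_eq\<close>)
qed

lemma card_used_split:
  "card (used M i) = card (used M i \<inter> {1..<L}) + of_bool (0 \<in> used M i)
     + of_bool (L \<in> used M i) + of_bool (L + 1 \<in> used M i)"
proof -
  let ?A = "used M i"
  have "?A \<subseteq> {..L + 1}" unfolding used_def by auto
  then have "x = 0 \<or> x \<in> {1..<L} \<or> x = L \<or> x = L + 1" if "x \<in> ?A" for x
    using that by fastforce
  then have "?A = ?A \<inter> {1..<L} \<union> {x. x = 0 \<and> 0 \<in> ?A} \<union> {x. x = L \<and> L \<in> ?A}
      \<union> {x. x = L + 1 \<and> L + 1 \<in> ?A}" (is "_ = ?B \<union> ?C \<union> ?D \<union> ?E")
    by blast
  moreover have "card (?B \<union> ?C \<union> ?D \<union> ?E) = card ?B + card ?C + card ?D + card ?E"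
  proof -
    have "(?B \<union> ?C \<union> ?D) \<inter> ?E = {}" "(?B \<union> ?C) \<inter> ?D = {}" "?B \<inter> ?C = {}"
      using L by auto
    moreover have "finite ?B" "finite ?C" "finite ?D" "finite ?E"
      by (simp_all add: finite_used)
    ultimately show ?thesis by (simp add: card_Un_disjoint del: Collect_conj_eq)
  qed
  ultimately show ?thesis by simp
qed

lemma L_le_card_reach:
  assumes "M \<subseteq> EE" "dominating_set VV EE (\<Union>M)" "i \<in> I"
  shows "L \<le> 4 * card (used M i \<inter> {1..<L}) + of_bool (U i \<in> \<Union>M)
     + of_bool (0 \<in> used M i) + of_bool (U (nxt i) \<in> \<Union>M) + of_bool (L \<in> used M i)"
proof -
  have "finite (reach M i)"
    unfolding reach_def by (simp add: finite_used)
  then have "L \<le> card (reach M i)"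
    using card_mono[OF _ petal_reached[OF assms]] by simp
  then show ?thesis using card_reach[of M i] by linarith
qed

text \<open>
  With fewer than \<open>k = L div 4\<close> interior edges, at least four vertices are left to the two ends,
  which reach that many only if both hubs are matched into the petal, and these are two more edges.
\<close>

lemma petal_uses_at_least:
  assumes "M \<subseteq> EE" "dominating_set VV EE (\<Union>M)" "i \<in> I"
  shows "L div 4 \<le> card (used M i)"
  using L_le_card_reach[OF assms] card_used_split[of M i]
  by (cases "0 \<in> used M i"; cases "L \<in> used M i"; cases "U i \<in> \<Union>M"; cases "U (nxt i) \<in> \<Union>M")
     (simp_all, linarith?)

definition tight :: "flower_vertex set set \<Rightarrow> nat \<Rightarrow> bool" where
  "tight M i \<longleftrightarrow> card (used M i) = L div 4"

text \<open>
  With \<open>k\<close> used edges, fewer than \<open>k\<close> interior ones is excluded by the count above, so all of them are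
  interior and reach at most \<open>4k\<close> positions. The remaining \<open>L mod 4\<close> vertices are left to the hubs. If
  neither hub is matched, then \<open>L = 4k\<close> and the interior edges waste nothing, so none of them reaches
  beyond the interior: neither end vertex of the petal is matched.
\<close>

lemma tightD:
  assumes M: "M \<subseteq> EE" "dominating_set VV EE (\<Union>M)" "i \<in> I" and t: "tight M i"
  shows "0 \<notin> used M i" "L \<notin> used M i" "L + 1 \<notin> used M i"
    and "L mod 4 \<le> of_bool (U i \<in> \<Union>M) + of_bool (U (nxt i) \<in> \<Union>M)"
    and "U i \<notin> \<Union>M \<Longrightarrow> U (nxt i) \<notin> \<Union>M \<Longrightarrow> 1 \<notin> used M i \<and> L - 1 \<notin> used M i"
proof -
  let ?a = "card (used M i \<inter> {1..<L})"
  have c: "L div 4 = ?a + of_bool (0 \<in> used M i)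
     + of_bool (L \<in> used M i) + of_bool (L + 1 \<in> used M i)"
    using t card_used_split[of M i] unfolding tight_def by simp
  have l: "L = 4 * (L div 4) + L mod 4" by simp
  show no: "0 \<notin> used M i" "L \<notin> used M i" "L + 1 \<notin> used M i"
    using L_le_card_reach[OF M] c l
    by (auto simp: of_bool_def split: if_splits) 
  then have a: "?a = L div 4" using c by simp
  then show le: "L mod 4 \<le> of_bool (U i \<in> \<Union>M) + of_bool (U (nxt i) \<in> \<Union>M)"
  proof -
    have "L \<le> 4 * ?a + of_bool (U i \<in> \<Union>M) + of_bool (U (nxt i) \<in> \<Union>M)"
      using L_le_card_reach[OF M] no by simp
    then show ?thesis using l a by linarith
  qed
  show "1 \<notin> used M i \<and> L - 1 \<notin> used M i" if h: "U i \<notin> \<Union>M" "U (nxt i) \<notin> \<Union>M"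
  proof (rule ccontr)
    assume used: "\<not> (1 \<notin> used M i \<and> L - 1 \<notin> used M i)"
    define R where "R = (\<Union>q\<in>used M i \<inter> {1..<L}. {q - 1..q + 2})"
    have "L mod 4 = 0" using le h by simp
    then have L4: "L = 4 * (L div 4)" "L \<ge> 4" using L by presburger+
    have "reach M i = R" unfolding reach_def R_def using h no by simp
    then have sub: "{1..L} \<subseteq> R" using petal_reached[OF M] by simp
    \<comment> \<open>the interior is covered without any slack, so a single position outside it is too much\<close>
    have cR: "finite R" "card R \<le> L"
      using card_inner_reach[of M i] a L4(1) unfolding R_def by (simp_all add: finite_used)
    have "0 \<in> R \<or> L + 1 \<in> R"
    proof (cases "1 \<in> used M i")
      case True
      then have "1 \<in> used M i \<inter> {1..<L}" "(0::nat) \<in> {1 - 1..1 + 2}" using L4 by auto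
      then show ?thesis unfolding R_def by blast
    next
      case False
      then have "L - 1 \<in> used M i \<inter> {1..<L}" "L + 1 \<in> {L - 1 - 1..L - 1 + 2}"
        using used L4 by auto
      then show ?thesis unfolding R_def by blast
    qed
    then obtain x where "x \<in> R" "x \<notin> {1..L}" by fastforce
    then have "card (insert x {1..L}) \<le> card R" using sub cR(1) by (intro card_mono) auto
    then show False using cR(2) \<open>x \<notin> {1..L}\<close> by simp
  qed
qed

text \<open>
  The four edges at a hub are an end edge and the chord of each of its two petals, and a tight petal
  uses none of these.
\<close>

lemma tight_tight_not_matched:
  assumes M: "M \<subseteq> EE" "dominating_set VV EE (\<Union>M)"
    and i: "i \<in> I" and t: "tight M i" "tight M (nxt i)"
  shows "U (nxt i) \<notin> \<Union>M"
proof
  assume "U (nxt i) \<in> \<Union>M"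
  with M(1) show False
  proof (cases rule: U_matched)
    case (1 j)
    then show False using tightD(1,3)[OF M nxt_in[OF i] t(2)] by simp
  next
    case (2 j)
    then have "j = i" using nxt_inj[OF i] by simp
    then show False using 2(3) tightD(2,3)[OF M i t(1)] by simp
  qed
qed

text \<open>
  By the previous lemma all hubs strictly inside a run of tight petals are unmatched, whereas tightness
  asks for \<open>L mod 4\<close> matched hubs at every petal. For residue \<open>3\<close> this fails at once; for residue \<open>2\<close> two
  petals share an unmatched hub; for residue \<open>1\<close> the middle one of three petals has two unmatched hubs.
  For residue \<open>0\<close> tightness puts no condition on the hubs, but the middle hub of four tight petals has
  only unmatched neighbours: two hubs, and two end vertices of petals with both hubs unmatched.
\<close>

lemma window_not_tight:
  assumes M: "M \<subseteq> EE" "dominating_set VV EE (\<Union>M)" and i: "i \<in> I"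
  shows "\<exists>d < 4 - L mod 4. \<not> tight M ((nxt ^^ d) i)"
proof (rule ccontr)
  assume "\<not> ?thesis"
  then have t: "tight M ((nxt ^^ d) i)" if "d < 4 - L mod 4" for d using that by blast
  define i1 i2 i3 where ii: "i1 = nxt i" "i2 = nxt i1" "i3 = nxt i2"
  have I: "i1 \<in> I" "i2 \<in> I" "i3 \<in> I" unfolding ii using nxt_in i by blast+
  have "L mod 4 < 4" by simp
  then consider "L mod 4 = 3" | "L mod 4 = 2" | "L mod 4 = 1" | "L mod 4 = 0" by linarith
  then show False
  proof cases
    case 1
    then show False using tightD(4)[OF M i] t[of 0]
      by (auto simp: of_bool_def split: if_splits)
  next
    case 2
    then have t0: "tight M i" and t1: "tight M i1" using t[of 0] t[of 1] by (simp_all add: ii)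
    have "U i1 \<notin> \<Union>M" using tight_tight_not_matched[OF M i] t0 t1 unfolding ii by blast
    then show False using tightD(4)[OF M i t0] 2 unfolding ii
      by (auto simp: of_bool_def split: if_splits)
  next
    case 3
    then have t0: "tight M i" and t1: "tight M i1" and t2: "tight M i2"
      using t[of 0] t[of 1] t[of 2] by (simp_all add: ii numeral_2_eq_2)
    have "U i1 \<notin> \<Union>M" "U i2 \<notin> \<Union>M"
      using tight_tight_not_matched[OF M i] tight_tight_not_matched[OF M I(1)] t0 t1 t2
      unfolding ii by blast+
    then show False using tightD(4)[OF M I(1) t1] 3 unfolding ii(2) by simp
  next
    case 4
    then have t0: "tight M i" and t1: "tight M i1" and t2: "tight M i2" and t3: "tight M i3"
      using t[of 0] t[of 1] t[of 2] t[of 3] by (simp_all add: ii numeral_2_eq_2 numeral_3_eq_3)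
    have U: "U i1 \<notin> \<Union>M" "U i2 \<notin> \<Union>M" "U i3 \<notin> \<Union>M"
      using tight_tight_not_matched[OF M i] tight_tight_not_matched[OF M I(1)]
        tight_tight_not_matched[OF M I(2)] t0 t1 t2 t3
      unfolding ii by blast+
    have "U i2 \<in> VV" using I mem_VV by simp
    then obtain y where y: "y \<in> \<Union>M" "{U i2, y} \<in> EE"
      using U(2) M(2) unfolding dominating_set_def by blast
    have no1: "0 \<notin> used M i2" "1 \<notin> used M i2"
      using tightD(1,5)[OF M I(2) t2] U unfolding ii(3) by auto
    have noL: "L \<notin> used M i1" "L - 1 \<notin> used M i1"
      using tightD(2,5)[OF M I(1) t1] U unfolding ii(2) by auto
    have "V i2 1 \<notin> \<Union>M"
    proof
      assume "V i2 1 \<in> \<Union>M"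
      with M(1) show False by (rule V_matched) (use no1 in auto)
    qed
    moreover have "V i1 L \<notin> \<Union>M"
    proof
      assume "V i1 L \<in> \<Union>M"
      with M(1) show False by (rule V_matched) (use noL in auto)
    qed
    moreover have "j = i1" if "j \<in> I" "i2 = nxt j" for j
      using nxt_inj[OF that(1) I(1)] that(2) unfolding ii(2) by simp
    ultimately show False using U_adjacent[OF y(2)] y(1) U unfolding ii(3)[symmetric] by blast
  qed
qed

lemma card_dominating_matching_ge:
  assumes M: "M \<subseteq> EE" "dominating_set VV EE (\<Union>M)"
  obtains z where "card M = n * (L div 4) + z" "n \<le> (4 - L mod 4) * z"
proof
  let ?z = "\<lambda>i. card (used M i) - L div 4"
  have "card M = (\<Sum>i\<in>I. L div 4 + ?z i)"
    unfolding card_eq_sum_used[OF M(1)]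
    by (rule sum.cong) (use petal_uses_at_least[OF M] in auto)
  then show "card M = n * (L div 4) + sum ?z I" by (simp add: sum.distrib)
  have "card I \<le> (4 - L mod 4) * sum ?z I"
  proof (rule card_le_window_sum[OF _ nxt_bij])
    fix i assume i: "i \<in> I"
    obtain d where d: "d < 4 - L mod 4" "\<not> tight M ((nxt ^^ d) i)"
      using window_not_tight[OF M i] by blast
    have "(nxt ^^ d) i \<in> I" using bij_betw_funpow[OF nxt_bij] i by (rule bij_betwE[THEN bspec])
    then show "\<exists>d<4 - L mod 4. ?z ((nxt ^^ d) i) > 0"
      using d petal_uses_at_least[OF M, of "(nxt ^^ d) i"] unfolding tight_def by force
  qed simp
  then show "n \<le> (4 - L mod 4) * sum ?z I" by simp
qed

section \<open>The upper bound\<close>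

text \<open>
  The matching consists of the edge from \<open>U i\<close> to \<open>V i 1\<close> for \<open>i \<in> X\<close>, the chord of petal \<open>i\<close> for \<open>i \<in> C\<close>,
  and in every petal \<open>L div 4\<close> interior edges at distance four from each other. The latter dominate
  the \<open>4 (L div 4)\<close> vertices that follow the first \<open>offset i\<close> ones; the vertices before and after
  these, at most two and at most one in number, are left to the hubs. The set \<open>H\<close> consists of the matched
  hubs, and the assumptions say that no hub is matched twice, that \<open>H\<close> dominates the hubs, and that
  it dominates the left-over vertices of every petal.
\<close>

lemma exists_dominating_matching:
  fixes X C :: "nat set" and offset :: "nat \<Rightarrow> nat"
  defines "H \<equiv> X \<union> C \<union> nxt ` C"
  assumes sub: "X \<subseteq> I" "C \<subseteq> I"
    and disj: "X \<inter> C = {}" "X \<inter> nxt ` C = {}" "C \<inter> nxt ` C = {}"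
    and hubs: "\<And>i. i \<in> I \<Longrightarrow> i \<in> H \<or> nxt i \<in> H \<or> (\<exists>p\<in>I. i = nxt p \<and> p \<in> H)"
    and offset: "\<And>i. i \<in> I \<Longrightarrow> offset i \<le> 2 \<and> offset i \<le> L mod 4 \<and> L mod 4 \<le> offset i + 1"
      "\<And>i. i \<in> I \<Longrightarrow> 1 \<le> offset i \<Longrightarrow> i \<in> H"
      "\<And>i. i \<in> I \<Longrightarrow> offset i = 2 \<Longrightarrow> i \<in> X"
      "\<And>i. i \<in> I \<Longrightarrow> offset i < L mod 4 \<Longrightarrow> nxt i \<in> H"
  obtains M where "M \<subseteq> EE" "matching M" "dominating_set VV EE (\<Union>M)"
    "card M \<le> card X + card C + n * (L div 4)"
proof
  let ?k = "L div 4"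
  let ?in = "\<lambda>(i, t). petal_edge i (offset i + 4 * t + 2)"
  define M where "M = (\<lambda>i. petal_edge i 0) ` X \<union> (\<lambda>i. petal_edge i (L + 1)) ` C \<union> ?in ` (I \<times> {..<?k})"
  have Lk: "L = 4 * ?k + L mod 4" by simp
  have inner: "offset i + 4 * t + 2 < L" if "i \<in> I" "t < ?k" for i t
    using that offset(1)[OF that(1)] Lk by linarith
  have M_cases: "(q = 0 \<and> i \<in> X) \<or> (q = L + 1 \<and> i \<in> C) \<or>
      (\<exists>t<?k. q = offset i + 4 * t + 2) \<and> 1 \<le> q \<and> q < L"
    if "petal_edge i q \<in> M" "i \<in> I" "q \<le> L + 1" for i q
  proof -
    have eqD: "i = j \<and> q = r" if "petal_edge i q = petal_edge j r" "j \<in> I" "r \<le> L + 1" for j r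
      using inj_onD[OF petal_edge_inj, of "(i, q)" "(j, r)"] that \<open>i \<in> I\<close> \<open>q \<le> L + 1\<close> by simp
    show ?thesis
      using that(1) unfolding M_def
    proof (elim UnE imageE)
      fix j assume "petal_edge i q = petal_edge j 0" "j \<in> X"
      then show ?thesis using eqD[of j 0] sub by blast
    next
      fix j assume "petal_edge i q = petal_edge j (L + 1)" "j \<in> C"
      then show ?thesis using eqD[of j "L + 1"] sub by blast
    next
      fix p assume p: "petal_edge i q = ?in p" "p \<in> I \<times> {..<?k}"
      obtain j t where jt: "p = (j, t)" "j \<in> I" "t < ?k" using p(2) by auto
      then have "i = j" "q = offset j + 4 * t + 2"
        using eqD[of j "offset j + 4 * t + 2"] p(1) inner[OF jt(2,3)] by simp_all
      then show ?thesis using jt inner[OF jt(2,3)] by auto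
    qed
  qed
  show M: "M \<subseteq> EE"
  proof
    fix e assume "e \<in> M"
    have EE: "petal_edge i q \<in> EE" if "i \<in> I" "q \<le> L + 1" for i q
      using that unfolding EE_eq by blast
    from \<open>e \<in> M\<close> show "e \<in> EE"
      unfolding M_def
    proof (elim UnE imageE)
      fix i assume "e = petal_edge i 0" "i \<in> X"
      then show ?thesis using EE[of i 0] sub by auto
    next
      fix i assume "e = petal_edge i (L + 1)" "i \<in> C"
      then show ?thesis using EE[of i "L + 1"] sub by auto
    next
      fix p assume p: "e = ?in p" "p \<in> I \<times> {..<?k}"
      obtain i t where it: "p = (i, t)" "i \<in> I" "t < ?k" using p(2) by auto
      then show ?thesis
        using EE[of i "offset i + 4 * t + 2"] p(1) inner[OF it(2,3)] by simp
    qed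
  qed
  show "matching M"
    unfolding matching_def
  proof (intro ballI impI)
    fix e f assume "e \<in> M" "f \<in> M" and "e \<inter> f \<noteq> {}"
    then obtain x where x: "x \<in> e" "x \<in> f" by blast
    obtain i q where e: "e = petal_edge i q" "i \<in> I" "q \<le> L + 1"
      using \<open>e \<in> M\<close> M unfolding EE_eq by blast
    obtain j r where f: "f = petal_edge j r" "j \<in> I" "r \<le> L + 1"
      using \<open>f \<in> M\<close> M unfolding EE_eq by blast
    have q: "(q = 0 \<and> i \<in> X) \<or> (q = L + 1 \<and> i \<in> C) \<or>
        (\<exists>t<?k. q = offset i + 4 * t + 2) \<and> 1 \<le> q \<and> q < L"
      using M_cases[of i q] \<open>e \<in> M\<close> e by simp
    have r: "(r = 0 \<and> j \<in> X) \<or> (r = L + 1 \<and> j \<in> C) \<or>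
        (\<exists>t<?k. r = offset j + 4 * t + 2) \<and> 1 \<le> r \<and> r < L"
      using M_cases[of j r] \<open>f \<in> M\<close> f by simp
    have "i = j \<and> q = r"
    proof (cases x)
      case (V a b)
      have b: "i = a" "b = q \<or> b = q + 1" "1 \<le> b" "b \<le> L" "j = a" "b = r \<or> b = r + 1"
        using V_in_petal_edge[of a b i q] V_in_petal_edge[of a b j r] x[unfolded V e(1) f(1)] e(3) f(3)
        by blast+
      have q': "q = 0 \<or> (\<exists>t. q = offset a + 4 * t + 2)" using q b by auto
      have r': "r = 0 \<or> (\<exists>t. r = offset a + 4 * t + 2)" using r b by auto
      \<comment> \<open>edges that share \<open>V a b\<close> are at most one position apart, but interior edges of the matching are at least four apart\<close>
      have near: "q \<le> r + 1" "r \<le> q + 1" using b(2,6) by linarith+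
      from q' r' have "q = r"
      proof (elim disjE exE)
        fix t u assume q: "q = offset a + 4 * t + 2" and r: "r = offset a + 4 * u + 2"
        then have "4 * t \<le> 4 * u + 1" "4 * u \<le> 4 * t + 1" using near by linarith+
        then have "t = u" by linarith
        then show ?thesis using q r by simp
      qed (use b near in linarith)+
      then show ?thesis using b by simp
    next
      case (U a)
      have "a = i \<and> (q = 0 \<or> q = L + 1) \<or> a = nxt i \<and> (q = L \<or> q = L + 1)"
        using U_in_petal_edge x(1) U e by metis
      then have q': "a = i \<and> q = 0 \<and> i \<in> X \<or> a = i \<and> q = L + 1 \<and> i \<in> C
          \<or> a = nxt i \<and> q = L + 1 \<and> i \<in> C"
        using q L by auto
      have "a = j \<and> (r = 0 \<or> r = L + 1) \<or> a = nxt j \<and> (r = L \<or> r = L + 1)"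
        using U_in_petal_edge x(2) U f by metis
      then have r': "a = j \<and> r = 0 \<and> j \<in> X \<or> a = j \<and> r = L + 1 \<and> j \<in> C
          \<or> a = nxt j \<and> r = L + 1 \<and> j \<in> C"
        using r L by auto
      have "i \<in> C \<Longrightarrow> j \<in> X \<union> C \<Longrightarrow> nxt i \<noteq> j" "j \<in> C \<Longrightarrow> i \<in> X \<union> C \<Longrightarrow> nxt j \<noteq> i"
        "i \<in> C \<Longrightarrow> j \<in> X \<Longrightarrow> i \<noteq> j" "i \<in> X \<Longrightarrow> j \<in> C \<Longrightarrow> i \<noteq> j" using disj by blast+
      then show ?thesis using q' r' nxt_inj[OF e(2) f(2)] by blast
    qed
    then show "e = f" using e f by simp
  qed
  have UM: "U i \<in> \<Union>M" if "i \<in> H" for i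
  proof -
    consider "i \<in> X" | "i \<in> C" | j where "j \<in> C" "i = nxt j"
      using \<open>i \<in> H\<close> unfolding H_def by blast
    then show ?thesis
    proof cases
      case 1
      then have "petal_edge i 0 \<in> M" unfolding M_def by blast
      moreover have "U i \<in> petal_edge i 0" by (simp add: petal_edge_def)
      ultimately show ?thesis ..
    next
      case 2
      then have "petal_edge i (L + 1) \<in> M" unfolding M_def by blast
      moreover have "U i \<in> petal_edge i (L + 1)" by (simp add: petal_edge_def)
      ultimately show ?thesis ..
    next
      case 3
      then have "petal_edge j (L + 1) \<in> M" unfolding M_def by blast
      moreover have "U i \<in> petal_edge j (L + 1)" using 3 by (simp add: petal_edge_def)
      ultimately show ?thesis ..
    qed
  qed
  have V1M: "V i 1 \<in> \<Union>M" if "i \<in> X" for i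
  proof -
    have "petal_edge i 0 \<in> M" using that unfolding M_def by blast
    moreover have "V i 1 \<in> petal_edge i 0" by (simp add: petal_edge_def)
    ultimately show ?thesis ..
  qed
  have VM: "V i (offset i + 4 * t + 2) \<in> \<Union>M" "V i (offset i + 4 * t + 3) \<in> \<Union>M"
    if "i \<in> I" "t < ?k" for i t
  proof -
    have "petal_edge i (offset i + 4 * t + 2) \<in> M"
      using that unfolding M_def by (intro UnI2 image_eqI[of _ _ "(i, t)"]) auto
    moreover have "petal_edge i (offset i + 4 * t + 2)
        = {V i (offset i + 4 * t + 2), V i (offset i + 4 * t + 3)}"
      using inner[OF that] by (simp add: petal_edge_def numeral_3_eq_3)
    ultimately show "V i (offset i + 4 * t + 2) \<in> \<Union>M" "V i (offset i + 4 * t + 3) \<in> \<Union>M"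
      by blast+
  qed
  have adj: "{V i b, V i (b + 1)} \<in> EE" if "i \<in> I" "1 \<le> b" "b < L" for i b
    using flower_edges_intros(2)[OF that(1), of b "L + 2"] that by simp
  show "dominating_set VV EE (\<Union>M)"
    unfolding dominating_set_def
  proof (intro conjI ballI)
    show "\<Union>M \<subseteq> VV"
    proof (rule Union_least)
      have "simple_graph VV EE" using simple_graph_flower[of "L + 2" n] n L by simp
      then show "e \<subseteq> VV" if "e \<in> M" for e using that M unfolding simple_graph_def by blast
    qed
    fix x assume x: "x \<in> VV - \<Union>M"
    show "\<exists>y\<in>\<Union>M. {x, y} \<in> EE"
    proof (cases x)
      case (U i)
      then have i: "i \<in> I" "i \<notin> H" using x mem_VV UM[of i] by blast+
      have chord: "{U j, U (nxt j)} \<in> EE" if "j \<in> I" for j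
      proof -
        have "petal_edge j (L + 1) \<in> EE" using that unfolding EE_eq by blast
        then show ?thesis by (simp add: petal_edge_def)
      qed
      consider "nxt i \<in> H" | p where "p \<in> I" "i = nxt p" "p \<in> H" using hubs[OF i(1)] i(2) by blast
      then show ?thesis
      proof cases
        case 1
        then show ?thesis using chord[OF i(1)] UM[OF 1] U by blast
      next
        case 2
        have "{x, U p} \<in> EE" using chord[OF 2(1)] U 2(2) by (simp add: insert_commute)
        then show ?thesis using UM[OF 2(3)] by blast
      qed
    next
      case (V i b)
      then have i: "i \<in> I" and b: "1 \<le> b" "b \<le> L" using x mem_VV(2)[of i b] by simp_all
      note o = offset(1)[OF i]
      consider "b \<le> offset i" | "offset i < b" "b \<le> offset i + 4 * ?k" | "offset i + 4 * ?k < b"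
        by linarith
      then show ?thesis
      proof cases
        case 1
        show ?thesis
        proof (cases "b = 1")
          case True
          have "U i \<in> \<Union>M" using offset(2)[OF i] 1 True UM by simp
          moreover have "{x, U i} \<in> EE"
            using flower_edges_intros(1)[OF i] V True by (simp add: insert_commute)
          ultimately show ?thesis by blast
        next
          case False
          then have "b = 2" "offset i = 2" using 1 o b by linarith+
          then have "V i 1 \<in> \<Union>M" using V1M offset(3)[OF i] by blast
          moreover have "{x, V i 1} \<in> EE"
            using adj[OF i, of 1] V \<open>b = 2\<close> b by (simp add: insert_commute numeral_2_eq_2)
          ultimately show ?thesis by blast
        qed
      next
        case 2
        \<comment> \<open>the interior edge whose four dominated vertices include position \<open>b\<close>\<close>
        define t where "t = (b - offset i - 1) div 4"
        have t: "t < ?k" unfolding t_def using 2 by (simp add: div_less_iff_less_mult)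
        have "b = offset i + 4 * t + 1 + (b - offset i - 1) mod 4"
          using 2 unfolding t_def by simp
        moreover have "(b - offset i - 1) mod 4 < 4" by simp
        ultimately consider "b + 1 = offset i + 4 * t + 2" | "b = offset i + 4 * t + 2"
          | "b = offset i + 4 * t + 3" | "b = offset i + 4 * t + 3 + 1" by linarith
        then show ?thesis
        proof cases
          case 1
          have "{V i b, V i (b + 1)} \<in> EE" using adj[OF i b(1)] inner[OF i t] 1 by linarith
          then show ?thesis using VM(1)[OF i t] unfolding V 1 by blast
        next
          case 2
          then show ?thesis using VM(1)[OF i t] V x by simp
        next
          case 3
          then show ?thesis using VM(2)[OF i t] V x by simp
        next
          case 4
          have "{V i (offset i + 4 * t + 3), V i b} \<in> EE"
            using adj[OF i, of "offset i + 4 * t + 3"] 4 b by simp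
          then have "{x, V i (offset i + 4 * t + 3)} \<in> EE" using V by (simp add: insert_commute)
          then show ?thesis using VM(2)[OF i t] by blast
        qed
      next
        case 3
        then have "b = L" "offset i < L mod 4" using o b Lk by linarith+
        then have "U (nxt i) \<in> \<Union>M" using offset(4)[OF i] UM by blast
        moreover have "petal_edge i L \<in> EE" using i unfolding EE_eq by force
        then have "{x, U (nxt i)} \<in> EE"
          using V \<open>b = L\<close> L by (simp add: petal_edge_def insert_commute)
        ultimately show ?thesis by blast
      qed
    qed
  qed
  have fin: "finite X" "finite C" using sub finite_subset by blast+
  have "card M \<le> card X + card C + card (I \<times> {..<?k})"
    unfolding M_def
    by (intro order_trans[OF card_Un_le] add_mono card_image_le fin finite_cartesian_product)
      simp_all
  then show "card M \<le> card X + card C + n * ?k" by simp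
qed

text \<open>
  With \<open>w = 4 - L mod 4\<close>, the hubs are grouped into blocks of \<open>w\<close>, starting at \<open>w t + 1\<close>, and the first
  two hubs of every complete block are matched with each other. The first hub of an incomplete last block
  is matched into its petal. The case \<open>w = 1\<close> is separate, since a block of one hub has no second
  hub: there every hub is matched into its petal, which dominates the first two of the three
  vertices missed by the interior edges, and the next hub dominates the third.
\<close>

lemma exists_small_dominating_matching:
  obtains M where "M \<subseteq> EE" "matching M" "dominating_set VV EE (\<Union>M)"
    "(4 - L mod 4) * (card M - n * (L div 4)) < n + (4 - L mod 4)"
proof (cases "L mod 4 = 3")
  case True
  obtain M where "M \<subseteq> EE" "matching M" "dominating_set VV EE (\<Union>M)"
    "card M \<le> card I + card ({} :: nat set) + n * (L div 4)"
    by (rule exists_dominating_matching[of I "{}" "\<lambda>_. 2"]) (use True nxt_in in auto)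
  then show thesis using that[of M] True by simp
next
  case False
  define w where "w = 4 - L mod 4"
  define k where "k = n div w"
  define X where "X = (if w dvd n then {} else {w * k + 1})"
  define C where "C = (\<lambda>t. w * t + 1) ` {..<k}"
  define H where "H = X \<union> C \<union> nxt ` C"
  define offset :: "nat \<Rightarrow> nat" where "offset i = (if L mod 4 = 0 then 0 else of_bool (i \<in> H))" for i
  have "L mod 4 < 4" by simp
  then have w: "w = 2 \<or> w = 3 \<or> w = 4" using False unfolding w_def by linarith
  have nk: "n = w * k + n mod w" "n mod w < w" using w unfolding k_def by auto
  have k_less: "w * k < n" if "\<not> w dvd n"
  proof -
    have "n mod w \<noteq> 0" using that by (simp add: dvd_eq_mod_eq_0)
    then show ?thesis using nk by linarith
  qed
  have X: "X \<subseteq> I" using k_less unfolding X_def by (auto simp: Suc_le_eq)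
  \<comment> \<open>blocks \<open>t < k\<close> are complete, and block \<open>k\<close> is the possibly empty rest\<close>
  have tk: "w * t + w \<le> w * k" if "t < k" for t
    using mult_le_mono2[of "t + 1" k w] that by simp
  have C: "C \<subseteq> I" using tk nk w unfolding C_def by fastforce
  have nxtC: "nxt ` C = (\<lambda>t. w * t + 2) ` {..<k}"
  proof -
    have "nxt (w * t + 1) = w * t + 2" if "t < k" for t
      using tk[OF that] nk w by (subst nxt_eq) auto
    then show ?thesis unfolding C_def image_image by (intro image_cong) auto
  qed
  have H0: "w * t + 1 \<in> H" if "w * t + 1 \<in> I" for t
  proof (cases "t < k")
    case True
    then show ?thesis unfolding H_def C_def by blast
  next
    case False
    have "w * t < n" using that by simp
    then have "t \<le> k" using w unfolding k_def
      by (metis less_eq_div_iff_mult_less_eq less_imp_le mult.commute zero_less_numeral)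
    then have "t = k" using False by simp
    then have "\<not> w dvd n" using \<open>w * t < n\<close> unfolding k_def by auto
    then show ?thesis using \<open>t = k\<close> unfolding H_def X_def by simp
  qed
  have H1: "w * t + 2 \<in> H" if "t < k" for t
    using that unfolding H_def nxtC by blast
  \<comment> \<open>the hub after the last one is the first hub of block \<open>0\<close>, so the hub \<open>n\<close> always has a matched neighbour\<close>
  have Hlast: "nxt n \<in> H" using H0[of 0] n nxt_eq[of n] by simp
  have Hwrap: "nxt (w * t + w) \<in> H" if "w * t + w \<in> I" for t
  proof (cases "w * t + w = n")
    case True
    then show ?thesis using Hlast by simp
  next
    case False
    then have "nxt (w * t + w) = w * (t + 1) + 1" using nxt_eq[OF that] by simp
    then show ?thesis using H0[of "t + 1"] nxt_in[OF that] by simp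
  qed
  have decomp: "\<exists>t b. i = w * t + b + 1 \<and> b < w \<and> t \<le> k" if "i \<in> I" for i
  proof (intro exI conjI)
    show "i = w * ((i - 1) div w) + (i - 1) mod w + 1" using that by simp
    show "(i - 1) mod w < w" using w by auto
    show "(i - 1) div w \<le> k" unfolding k_def using that by (intro div_le_mono) auto
  qed
  have last_block: "t < k \<or> i = n" if "i \<in> I" "i = w * t + b + 1" "t \<le> k" "b + 2 = w" for i t b
  proof (cases "t < k")
    case False
    then have "i = w * k + b + 1" "i \<le> n" using that by simp_all
    then show ?thesis using nk that(4) by linarith
  qed simp
  have all_hubs: "i \<in> H" if w2: "w = 2" and i: "i \<in> I" for i
  proof -
    obtain t b where tb: "i = w * t + b + 1" "b < w" "t \<le> k" using decomp[OF i] by blast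
    consider "b = 0" | "b = 1" using tb(2) w2 by linarith
    then show ?thesis
    proof cases
      case 1
      then show ?thesis using H0[of t] tb(1) i by simp
    next
      case 2
      then have "w * t + w \<le> n" using tb(1) w2 i by simp
      moreover have "n < w * k + w" using nk by linarith
      ultimately have "t \<noteq> k" by auto
      then have "t < k" using tb(3) by simp
      then show ?thesis using H1[of t] tb(1) 2 by simp
    qed
  qed

  obtain M where "M \<subseteq> EE" "matching M" "dominating_set VV EE (\<Union>M)"
    "card M \<le> card X + card C + n * (L div 4)"
  proof (rule exists_dominating_matching[of X C offset])
    show "X \<inter> C = {}" using w unfolding X_def C_def by auto
    show "X \<inter> nxt ` C = {}"
    proof -
      have "w * k + 1 \<noteq> w * t + 2" if "t < k" for t using tk[OF that] w by linarith
      then show ?thesis unfolding nxtC X_def by (auto split: if_splits)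
    qed
    show "C \<inter> nxt ` C = {}"
    proof -
      have "w * t + 1 \<noteq> w * s + 2" for t s using w by (elim disjE) (simp, presburger)+
      then show ?thesis unfolding nxtC unfolding C_def by auto
    qed
    fix i assume i: "i \<in> I"
    then obtain t b where tb: "i = w * t + b + 1" "b < w" "t \<le> k" using decomp by blast
    show "i \<in> X \<union> C \<union> nxt ` C \<or> nxt i \<in> X \<union> C \<union> nxt ` C
        \<or> (\<exists>p\<in>I. i = nxt p \<and> p \<in> X \<union> C \<union> nxt ` C)"
      unfolding H_def[symmetric]
    proof -
      have pred: "\<exists>p\<in>I. i = nxt p \<and> p \<in> H" if "i = p + 1" "1 \<le> p" "p \<in> H" for p
        by (rule bexI[of _ p]) (use that i nxt_eq[of p] in auto)
      consider "b = 0" | "b = 1" | "b + 1 = w" | "b = 2" "b + 2 = w"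
        using w tb(2) by linarith
      then show "i \<in> H \<or> nxt i \<in> H \<or> (\<exists>p\<in>I. i = nxt p \<and> p \<in> H)"
      proof cases
        case 1
        then show ?thesis using H0[of t] tb(1) i by simp
      next
        case 2
        then show ?thesis using H0[of t] pred[of "w * t + 1"] tb(1) i by simp
      next
        case 3
        then have "i = w * t + w" using tb(1) by linarith
        then show ?thesis using Hwrap[of t] i by blast
      next
        case 4
        then consider "t < k" | "i = n" using last_block[OF i tb(1,3)] by blast
        then show ?thesis
        proof cases
          case 1
          then show ?thesis using H1[of t] pred[of "w * t + 2"] tb(1) 4(1) by simp
        next
          case 2
          then show ?thesis using Hlast by simp
        qed
      qed
    qed
    have Lw: "L mod 4 + w = 4" unfolding w_def by simp
    show "offset i \<le> 2 \<and> offset i \<le> L mod 4 \<and> L mod 4 \<le> offset i + 1"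
      using w Lw all_hubs[OF _ i] unfolding offset_def by auto
    show "1 \<le> offset i \<Longrightarrow> i \<in> X \<union> C \<union> nxt ` C"
      unfolding H_def[symmetric] offset_def by (cases "i \<in> H") (simp_all split: if_splits)
    show "offset i = 2 \<Longrightarrow> i \<in> X"
      unfolding offset_def by (cases "i \<in> H") (simp_all split: if_splits)
    show "nxt i \<in> X \<union> C \<union> nxt ` C" if "offset i < L mod 4"
      unfolding H_def[symmetric]
    proof (cases "w = 2")
      case True
      then show "nxt i \<in> H" using all_hubs nxt_in[OF i] by blast
    next
      case False
      then have "L mod 4 = 1" "w = 3" using w Lw that by auto
      then have "i \<notin> H" using that unfolding offset_def by auto
      consider "b = 0" | "b + 2 = w" | "b + 1 = w" using tb(2) \<open>w = 3\<close> by linarith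
      then show "nxt i \<in> H"
      proof cases
        case 1
        then show ?thesis using H0[of t] tb(1) i \<open>i \<notin> H\<close> by simp
      next
        case 2
        then have "i = w * t + 2" using tb(1) \<open>w = 3\<close> by simp
        then have "\<not> t < k" using H1[of t] \<open>i \<notin> H\<close> by blast
        then show ?thesis using last_block[OF i tb(1,3) 2] Hlast by blast
      next
        case 3
        then have "i = w * t + w" using tb(1) by linarith
        then show ?thesis using Hwrap[of t] i by blast
      qed
    qed
  qed (use X C in auto)
  moreover have cXC: "w * (card X + card C) < n + w"
  proof -
    have "card C \<le> k" unfolding C_def using card_image_le[of "{..<k}"] by fastforce
    then have "w * card C \<le> w * k" by simp
    then show ?thesis using nk(1) w k_less unfolding X_def by (auto simp: add_mult_distrib2)
  qed
  moreover have "w * (card M - n * (L div 4)) < n + w" if "card M \<le> card X + card C + n * (L div 4)" for M :: "flower_vertex set set"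
  proof -
    have "w * (card M - n * (L div 4)) \<le> w * (card X + card C)"
      using that by (intro mult_le_mono2) simp
    then show ?thesis using cXC by linarith
  qed
  ultimately show thesis using that unfolding w_def by blast
qed

lemma paired_domination_number_flower:
  "int (paired_domination_number VV EE) =
     2 * (int (n * (L div 4)) + \<lceil>real n / real (4 - L mod 4)\<rceil>)"
proof -
  define w where "w = 4 - L mod 4"
  have w: "w > 0" unfolding w_def by simp
  obtain M where M: "M \<subseteq> EE" "matching M" "dominating_set VV EE (\<Union>M)"
    and less: "w * (card M - n * (L div 4)) < n + w"
    using exists_small_dominating_matching unfolding w_def by blast
  obtain z where z: "card M = n * (L div 4) + z" "n \<le> w * z"
    using card_dominating_matching_ge[OF M(1,3)] unfolding w_def by blast
  have zw: "w * z < n + w" using less z(1) by simp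
  have "paired_domination_number VV EE = 2 * card M"
  proof (rule paired_domination_number_eqI[OF _ _ M])
    show "simple_graph VV EE" using simple_graph_flower[of "L + 2" n] n L by simp
    fix M' assume "M' \<subseteq> EE" "dominating_set VV EE (\<Union>M')"
    then obtain z' where z': "card M' = n * (L div 4) + z'" "n \<le> w * z'"
      using card_dominating_matching_ge unfolding w_def by blast
    then have "w * z < w * (z' + 1)" using zw by simp
    then have "z < z' + 1" using mult_less_cancel1 by blast
    then show "card M \<le> card M'" using z(1) z'(1) by simp
  qed simp
  moreover have "\<lceil>real n / real w\<rceil> = int z"
  proof (rule ceiling_unique)
    have "real w * real z < real n + real w" using zw by (metis of_nat_add of_nat_less_iff of_nat_mult)
    then show "of_int (int z) - 1 < real n / real w"
      using w by (simp add: field_simps)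
    have "real n \<le> real w * real z" using z(2) by (metis of_nat_le_iff of_nat_mult)
    then show "real n / real w \<le> of_int (int z)"
      using w by (simp add: field_simps)
  qed
  ultimately show ?thesis using z(1) unfolding w_def by simp
qed

end

theorem theorem2p2:
  fixes m n :: nat
  assumes "m \<ge> 3" and "n \<ge> 3"
  shows "int (paired_domination_number (flower_vertices n m) (flower_edges n m)) =
    (if m mod 4 = 0 then 2 * \<lceil>(real n * real m - 2 * real n) / 4\<rceil>
     else if m mod 4 = 1 \<or> m mod 4 = 2 then 2 * \<lceil>(real n * real m - real n) / 4\<rceil>
     else 2 * \<lceil>(3 * real n * real m - 5 * real n) / 12\<rceil>)"
proof -
  define L where "L = m - 2"
  define k where "k = L div 4"
  have m: "m = L + 2" and "L \<ge> 1" using assms(1) unfolding L_def by simp_all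
  interpret flower n L by standard (use assms \<open>L \<ge> 1\<close> in simp_all)
  have *: "int (paired_domination_number (flower_vertices n m) (flower_edges n m))
      = 2 * \<lceil>real n / real (4 - L mod 4) + real n * real k\<rceil>"
  proof -
    have "real n * real k = of_int (int (n * k))" by simp
    then have "\<lceil>real n / real (4 - L mod 4) + real n * real k\<rceil>
        = \<lceil>real n / real (4 - L mod 4)\<rceil> + int (n * k)"
      by (simp only: ceiling_add_of_int)
    then show ?thesis using paired_domination_number_flower unfolding m k_def by simp
  qed
  have L: "L = 4 * k + L mod 4" unfolding k_def by simp
  have "L mod 4 < 4" by simp
  then consider "L mod 4 = 0" | "L mod 4 = 1" | "L mod 4 = 2" | "L mod 4 = 3" by linarith
  then show ?thesis
  proof cases
    case 1
    then have m4: "m = 4 * k + 2" using L m by simp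
    then have eq: "real n / real (4 - L mod 4) + real n * real k = (real n * real m - real n) / 4"
      using 1 by (simp add: field_simps)
    have "m mod 4 = 2" using m4 by presburger
    then show ?thesis unfolding * eq by simp
  next
    case 2
    then have m4: "m = 4 * k + 3" using L m by simp
    then have eq: "real n / real (4 - L mod 4) + real n * real k = (3 * real n * real m - 5 * real n) / 12"
      using 2 by (simp add: field_simps)
    have "m mod 4 = 3" using m4 by presburger
    then show ?thesis unfolding * eq by simp
  next
    case 3
    then have m4: "m = 4 * k + 4" using L m by simp
    then have eq: "real n / real (4 - L mod 4) + real n * real k = (real n * real m - 2 * real n) / 4"
      using 3 by (simp add: field_simps)
    have "m mod 4 = 0" using m4 by presburger
    then show ?thesis unfolding * eq by simp
  next
    case 4
    then have m4: "m = 4 * k + 5" using L m by simp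
    then have eq: "real n / real (4 - L mod 4) + real n * real k = (real n * real m - real n) / 4"
      using 4 by (simp add: field_simps)
    have "m mod 4 = 1" using m4 by presburger
    then show ?thesis unfolding * eq by simp
  qed
qed

end
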